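(* Let $\mathcal{X}$ be a finite set, let $\pi$ be a probability measure on $\mathcal{X}$ with strictly positive masses, and let $P$ be a $\pi$-reversible transition matrix on $\mathcal{X}$. For $S\subset\mathcal{X}$, $S\ne\emptyset,\mathcal{X}$, with complement $S'$, let $G_S$ be the Gibbs kernel of the partition $\mathcal{X}=S\sqcup S'$ and let $$g(S)=\frac{1}{\pi(S)\pi(S')}\sum_{x\in S,\,y\in S'}\pi(x)P^2(x,y).$$ Then for every $S\neq\emptyset,\mathcal{X}$, $$\|G_SP-\Pi\|_{F,\pi}^2=1-g(S).$$ In particular, if $S^*$ is a symmetrised Cheeger's cut of $P^2$, then $\|G_{S^*}P-\Pi\|_{F,\pi}^2=1-\phi^*(P^2)$. Moreover, $$\operatorname*{arg\,min}_{S\ne\mathcal{X},\emptyset}\|G_SP-\Pi\|_{F,\pi}^2=\operatorname*{arg\,max}_{S\ne\mathcal{X},\emptyset}g(S)\quad\text{and}\quad\operatorname*{arg\,max}_{S\ne\mathcal{X},\emptyset}\|G_SP-\Pi\|_{F,\pi}^2=\operatorname*{arg\,min}_{S\ne\mathcal{X},\emptyset}g(S).$$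
   Context: $G_S(x,y)=\pi(y)/\pi(S)$ if $x,y\in S$, $G_S(x,y)=\pi(y)/\pi(S')$ if $x,y\in S'$, and $G_S(x,y)=0$ otherwise, where $\pi(A)=\sum_{z\in A}\pi(z)$. $\Pi$ is the matrix all of whose rows equal $\pi$. $\|M\|_{F,\pi}^2=\mathrm{Tr}(M^*M)$ with $M^*(x,y)=\frac{\pi(y)}{\pi(x)}M(y,x)$ the $\ell^2(\pi)$-adjoint. $P^2$ is the matrix square of $P$. The symmetrised Cheeger's constant of a transition matrix $Q$ is $\phi^*(Q)=\min_{S:\,0<\pi(S)<1}\frac{\sum_{x\in S,\,y\in S'}\pi(x)Q(x,y)}{\pi(S)\pi(S')}$, and a symmetrised Cheeger's cut of $Q$ is any set attaining this minimum. *)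

theory Defs
  imports "HOL-Probability.Probability"
begin

text \<open>
  The finite state space is the universe of a type \<open>'x\<close> of class \<open>finite\<close>; a matrix \<open>M\<close> on it has
  type \<open>real^'x^'x\<close>, with \<open>M(x,y)\<close> written \<open>M $ x $ y\<close>, and a set \<open>S'\<close> is the complement \<open>- S\<close>.
\<close>

definition transition_matrix :: "real^'x^'x \<Rightarrow> bool" where
  "transition_matrix P \<longleftrightarrow> (\<forall>x y. 0 \<le> P $ x $ y) \<and> (\<forall>x. (\<Sum>y\<in>UNIV. P $ x $ y) = 1)"

definition reversible :: "'x::finite pmf \<Rightarrow> real^'x^'x \<Rightarrow> bool" where
  "reversible \<pi> P \<longleftrightarrow> (\<forall>x y. pmf \<pi> x * P $ x $ y = pmf \<pi> y * P $ y $ x)"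

definition gibbs_kernel :: "'x::finite pmf \<Rightarrow> 'x set \<Rightarrow> real^'x^'x" where
  "gibbs_kernel \<pi> S = (\<chi> x y.
     if x \<in> S \<and> y \<in> S then pmf \<pi> y / measure_pmf.prob \<pi> S
     else if x \<in> - S \<and> y \<in> - S then pmf \<pi> y / measure_pmf.prob \<pi> (- S)
     else 0)"

definition stationary_matrix :: "'x::finite pmf \<Rightarrow> real^'x^'x" where
  "stationary_matrix \<pi> = (\<chi> x y. pmf \<pi> y)"

definition adjoint_matrix :: "'x::finite pmf \<Rightarrow> real^'x^'x \<Rightarrow> real^'x^'x" where
  "adjoint_matrix \<pi> M = (\<chi> x y. pmf \<pi> y / pmf \<pi> x * M $ y $ x)"

definition frobenius_norm :: "'x::finite pmf \<Rightarrow> real^'x^'x \<Rightarrow> real" where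
  "frobenius_norm \<pi> M = sqrt (trace (adjoint_matrix \<pi> M ** M))"

definition cheeger_ratio :: "'x::finite pmf \<Rightarrow> real^'x^'x \<Rightarrow> 'x set \<Rightarrow> real" where
  "cheeger_ratio \<pi> Q S =
     (\<Sum>x\<in>S. \<Sum>y\<in>- S. pmf \<pi> x * Q $ x $ y) / (measure_pmf.prob \<pi> S * measure_pmf.prob \<pi> (- S))"

definition cheeger_admissible :: "'x::finite pmf \<Rightarrow> 'x set \<Rightarrow> bool" where
  "cheeger_admissible \<pi> S \<longleftrightarrow> 0 < measure_pmf.prob \<pi> S \<and> measure_pmf.prob \<pi> S < 1"

text \<open>
  The minimum is over a finite set of values. That set is empty, and the constant unspecified, when
  \<open>\<pi>\<close> is concentrated on one point; there is then no cut either.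
\<close>

definition cheeger_constant :: "'x::finite pmf \<Rightarrow> real^'x^'x \<Rightarrow> real" where
  "cheeger_constant \<pi> Q = Min (cheeger_ratio \<pi> Q ` {S. cheeger_admissible \<pi> S})"

definition cheeger_cut :: "'x::finite pmf \<Rightarrow> real^'x^'x \<Rightarrow> 'x set \<Rightarrow> bool" where
  "cheeger_cut \<pi> Q S \<longleftrightarrow> cheeger_admissible \<pi> S \<and> cheeger_ratio \<pi> Q S = cheeger_constant \<pi> Q"

definition two_step_flow :: "'x::finite pmf \<Rightarrow> real^'x^'x \<Rightarrow> 'x set \<Rightarrow> real" where
  "two_step_flow \<pi> P S =
     1 / (measure_pmf.prob \<pi> S * measure_pmf.prob \<pi> (- S))
       * (\<Sum>x\<in>S. \<Sum>y\<in>- S. pmf \<pi> x * (P ** P) $ x $ y)"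

end

theory Submission
  imports Defs
begin

text \<open>
  Put $p(y) = \sum_{z \in S} P(y,z)$. By reversibility the rows of $G_S P$ are $\pi p / \pi(S)$ on $S$
  and $\pi (1 - p) / \pi(S')$ on $S'$, so $\|G_S P - \Pi\|^2$ is the variance of $p$ under $\pi$
  divided by $\pi(S)\pi(S')$. The mean of $p$ is $\pi(S)$, and the $P^2$-flow out of $S$ is
  $\sum_y \pi(y) p(y) (1 - p(y))$; the sum of this flow and the variance is therefore
  $\pi(S) - \pi(S)^2 = \pi(S)\pi(S')$.
\<close>

text \<open>The diagonal entries of \<open>adjoint_matrix \<pi> M ** M\<close> are weighted sums of
  squares. The trace is thus nonnegative, and squaring undoes the \<open>sqrt\<close>.\<close>

lemma frobenius_norm_squared:
  "(frobenius_norm \<pi> M)\<^sup>2 = (\<Sum>y\<in>UNIV. \<Sum>x\<in>UNIV. pmf \<pi> x / pmf \<pi> y * (M $ x $ y)\<^sup>2)"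
proof -
  have "trace (adjoint_matrix \<pi> M ** M)
      = (\<Sum>y\<in>UNIV. \<Sum>x\<in>UNIV. pmf \<pi> x / pmf \<pi> y * (M $ x $ y)\<^sup>2)"
    by (simp add: trace_def matrix_matrix_mult_def adjoint_matrix_def power2_eq_square mult.assoc)
  moreover have "\<dots> \<ge> 0"
    by (intro sum_nonneg mult_nonneg_nonneg divide_nonneg_nonneg) auto
  ultimately show ?thesis
    by (simp add: frobenius_norm_def)
qed

lemma prob_eq_sum:
  fixes \<pi> :: "'x::finite pmf"
  shows "measure_pmf.prob \<pi> S = (\<Sum>x\<in>S. pmf \<pi> x)"
  by (simp add: measure_measure_pmf_finite)

lemma prob_Compl: "measure_pmf.prob \<pi> (- S) = 1 - measure_pmf.prob \<pi> S"
  using measure_pmf.prob_compl[of S \<pi>] by (simp add: Compl_eq_Diff_UNIV)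

lemma prob_pos:
  fixes \<pi> :: "'x::finite pmf"
  assumes "\<forall>x. 0 < pmf \<pi> x" "S \<noteq> {}"
  shows "0 < measure_pmf.prob \<pi> S"
  unfolding prob_eq_sum using assms by (intro sum_pos) auto

lemma sum_Compl_transition_matrix:
  assumes "transition_matrix P"
  shows "(\<Sum>z\<in>- S. P $ y $ z) = 1 - (\<Sum>z\<in>S. P $ y $ z)"
proof -
  have "(\<Sum>z\<in>UNIV. P $ y $ z) = (\<Sum>z\<in>S. P $ y $ z) + (\<Sum>z\<in>- S. P $ y $ z)"
    by (subst sum.union_disjoint[symmetric]) auto
  then show ?thesis
    using assms by (simp add: transition_matrix_def)
qed

lemma reversible_sum:
  assumes "reversible \<pi> P"
  shows "(\<Sum>x\<in>S. pmf \<pi> x * P $ x $ y) = pmf \<pi> y * (\<Sum>x\<in>S. P $ y $ x)"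
  using assms by (simp add: reversible_def sum_distrib_left)

text \<open>Row \<open>x\<close> of the Gibbs kernel is \<open>\<pi>\<close> conditioned on the
  block \<open>T\<close> of \<open>x\<close>. Detailed balance turns the flow from \<open>T\<close>
  into \<open>y\<close> around, so that \<open>x\<close> enters only through its block.\<close>

lemma gibbs_kernel_mult:
  assumes "reversible \<pi> P"
  shows "(gibbs_kernel \<pi> S ** P) $ x $ y =
    (let T = if x \<in> S then S else - S
     in pmf \<pi> y * (\<Sum>z\<in>T. P $ y $ z) / measure_pmf.prob \<pi> T)"
proof -
  define T where "T = (if x \<in> S then S else - S)"
  have "gibbs_kernel \<pi> S $ x $ z = (if z \<in> T then pmf \<pi> z / measure_pmf.prob \<pi> T else 0)" for z
    by (auto simp: gibbs_kernel_def T_def)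
  then have "(gibbs_kernel \<pi> S ** P) $ x $ y
      = (\<Sum>z\<in>UNIV. if z \<in> T then pmf \<pi> z * P $ z $ y / measure_pmf.prob \<pi> T else 0)"
    by (auto simp: matrix_matrix_mult_def intro!: sum.cong)
  also have "\<dots> = (\<Sum>z\<in>T. pmf \<pi> z * P $ z $ y) / measure_pmf.prob \<pi> T"
    by (simp add: sum.If_cases sum_divide_distrib)
  finally show ?thesis
    unfolding reversible_sum[OF assms] T_def Let_def .
qed

text \<open>Two-step paths from \<open>S\<close> to its complement are grouped by their midpoint.
  Reversing the first step makes both steps start there: one goes into \<open>S\<close>, the other
  out of it.\<close>

lemma two_step_flow_eq:
  assumes "transition_matrix P" "reversible \<pi> P"
  shows "two_step_flow \<pi> P S =
    (\<Sum>y\<in>UNIV. pmf \<pi> y * (\<Sum>z\<in>S. P $ y $ z) * (1 - (\<Sum>z\<in>S. P $ y $ z)))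
      / (measure_pmf.prob \<pi> S * measure_pmf.prob \<pi> (- S))"
proof -
  have "(\<Sum>x\<in>S. \<Sum>y\<in>- S. pmf \<pi> x * (P ** P) $ x $ y)
      = (\<Sum>x\<in>S. \<Sum>y\<in>- S. \<Sum>z\<in>UNIV. pmf \<pi> x * P $ x $ z * P $ z $ y)"
    by (simp add: matrix_matrix_mult_def sum_distrib_left mult.assoc)
  also have "\<dots> = (\<Sum>x\<in>S. \<Sum>z\<in>UNIV. \<Sum>y\<in>- S. pmf \<pi> x * P $ x $ z * P $ z $ y)"
    by (intro sum.cong refl sum.swap)
  also have "\<dots> = (\<Sum>z\<in>UNIV. \<Sum>x\<in>S. \<Sum>y\<in>- S. pmf \<pi> x * P $ x $ z * P $ z $ y)"
    by (rule sum.swap)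
  also have "\<dots> = (\<Sum>z\<in>UNIV. (\<Sum>x\<in>S. pmf \<pi> x * P $ x $ z) * (\<Sum>y\<in>- S. P $ z $ y))"
    by (simp add: sum_product)
  finally show ?thesis
    by (simp add: two_step_flow_def reversible_sum[OF assms(2)]
        sum_Compl_transition_matrix[OF assms(1)])
qed

lemma frobenius_norm_gibbs_kernel:
  fixes \<pi> :: "'x::finite pmf"
  assumes pos: "\<forall>x. 0 < pmf \<pi> x" and trans: "transition_matrix P" and rev: "reversible \<pi> P"
    and S: "S \<noteq> {}" "S \<noteq> UNIV"
  shows "(frobenius_norm \<pi> (gibbs_kernel \<pi> S ** P - stationary_matrix \<pi>))\<^sup>2
    = 1 - two_step_flow \<pi> P S"
proof -
  define a where "a = measure_pmf.prob \<pi> S"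
  define p where "p y = (\<Sum>z\<in>S. P $ y $ z)" for y
  have a: "0 < a" "0 < 1 - a"
    using prob_pos[OF pos, of S] prob_pos[OF pos, of "- S"] S
    by (auto simp: a_def prob_Compl)
  have total: "(\<Sum>y\<in>UNIV. pmf \<pi> y) = 1"
    using prob_eq_sum[of \<pi> UNIV] by simp
  \<comment> \<open>This is stationarity of \<open>\<pi>\<close>: after the swap, detailed balance
    summed over all of \<open>UNIV\<close> meets a row sum equal to 1.\<close>
  have mean: "(\<Sum>y\<in>UNIV. pmf \<pi> y * p y) = a"
  proof -
    have "(\<Sum>y\<in>UNIV. pmf \<pi> y * p y) = (\<Sum>z\<in>S. \<Sum>y\<in>UNIV. pmf \<pi> y * P $ y $ z)"
      unfolding p_def sum_distrib_left by (rule sum.swap)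
    also have "\<dots> = a"
      using trans by (simp add: reversible_sum[OF rev] transition_matrix_def a_def prob_eq_sum)
    finally show ?thesis .
  qed
  let ?M = "gibbs_kernel \<pi> S ** P - stationary_matrix \<pi>"
  \<comment> \<open>The two blocks share the factor \<open>p y - a\<close> up to sign, because
    \<open>(1 - p y) - (1 - a) = - (p y - a)\<close>.\<close>
  have entry: "?M $ x $ y = (if x \<in> S then 1 / a else - 1 / (1 - a)) * (pmf \<pi> y * (p y - a))" for x y
  proof -
    have "pmf \<pi> y * p y / a - pmf \<pi> y = 1 / a * (pmf \<pi> y * (p y - a))"
      using a by (simp add: field_simps)
    moreover have "pmf \<pi> y * (1 - p y) / b - pmf \<pi> y = - 1 / b * (pmf \<pi> y * (p y - (1 - b)))"
      if "0 < b" for b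
      using that by (simp add: field_simps)
    from this[of "1 - a"] have "pmf \<pi> y * (1 - p y) / (1 - a) - pmf \<pi> y
        = - 1 / (1 - a) * (pmf \<pi> y * (p y - a))"
      using a by simp
    ultimately show ?thesis
      by (simp add: gibbs_kernel_mult[OF rev] stationary_matrix_def prob_Compl
          sum_Compl_transition_matrix[OF trans] flip: a_def p_def)
  qed
  \<comment> \<open>Each column is constant on either block. The blocks have masses \<open>a\<close>
    and \<open>1 - a\<close>, so the squared scalars contribute
    \<open>1 / a + 1 / (1 - a) = 1 / (a * (1 - a))\<close>.\<close>
  have column: "(\<Sum>x\<in>UNIV. pmf \<pi> x / pmf \<pi> y * (?M $ x $ y)\<^sup>2)
      = pmf \<pi> y * (p y - a)\<^sup>2 / (a * (1 - a))" for y
  proof -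
    have "pmf \<pi> y \<noteq> 0"
      using pos by (metis less_irrefl)
    then have "(\<Sum>x\<in>UNIV. pmf \<pi> x / pmf \<pi> y * (?M $ x $ y)\<^sup>2)
        = (\<Sum>x\<in>UNIV. (if x \<in> S then pmf \<pi> x / a\<^sup>2 else pmf \<pi> x / (1 - a)\<^sup>2)
            * (pmf \<pi> y * (p y - a)\<^sup>2))"
      unfolding entry by (intro sum.cong) (auto simp: power2_eq_square)
    also have "\<dots> = ((\<Sum>x\<in>S. pmf \<pi> x) / a\<^sup>2 + (\<Sum>x\<in>- S. pmf \<pi> x) / (1 - a)\<^sup>2)
        * (pmf \<pi> y * (p y - a)\<^sup>2)"
      by (simp add: sum_distrib_right[symmetric] sum.If_cases sum_divide_distrib)
    also have "\<dots> = (a / a\<^sup>2 + (1 - a) / (1 - a)\<^sup>2) * (pmf \<pi> y * (p y - a)\<^sup>2)"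
      by (simp add: prob_eq_sum[symmetric] prob_Compl a_def)
    also have "a / a\<^sup>2 + (1 - a) / (1 - a)\<^sup>2 = 1 / (a * (1 - a))"
    proof -
      have "a / a\<^sup>2 + b / b\<^sup>2 = (a + b) / (a * b)" if "0 < b" for b
        using a that by (simp add: power2_eq_square field_simps)
      from this[of "1 - a"] show ?thesis
        using a by simp
    qed
    finally show ?thesis
      by simp
  qed
  \<comment> \<open>The squares of \<open>p y\<close> cancel termwise. What remains is affine in
    \<open>p y\<close>, so \<open>mean\<close> and \<open>total\<close> evaluate the sum.\<close>
  have "(\<Sum>y\<in>UNIV. pmf \<pi> y * (p y - a)\<^sup>2) + (\<Sum>y\<in>UNIV. pmf \<pi> y * p y * (1 - p y))
      = (\<Sum>y\<in>UNIV. (1 - 2 * a) * (pmf \<pi> y * p y) + a\<^sup>2 * pmf \<pi> y)"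
    by (simp add: sum.distrib[symmetric] power2_eq_square algebra_simps)
  also have "\<dots> = (1 - 2 * a) * a + a\<^sup>2"
    unfolding sum.distrib sum_distrib_left[symmetric] mean total by simp
  also have "\<dots> = a * (1 - a)"
    by (simp add: power2_eq_square algebra_simps)
  finally have "(\<Sum>y\<in>UNIV. pmf \<pi> y * (p y - a)\<^sup>2)
      = a * (1 - a) - (\<Sum>y\<in>UNIV. pmf \<pi> y * p y * (1 - p y))"
    by simp
  moreover have "two_step_flow \<pi> P S = (\<Sum>y\<in>UNIV. pmf \<pi> y * p y * (1 - p y)) / (a * (1 - a))"
    by (simp add: two_step_flow_eq[OF trans rev] p_def a_def prob_Compl)
  ultimately show ?thesis
    using a unfolding frobenius_norm_squared column
    by (simp add: sum_divide_distrib[symmetric] diff_divide_distrib)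
qed

theorem proposition4p6:
  fixes \<pi> :: "'x::finite pmf" and P :: "real^'x^'x"
  assumes "\<forall>x. 0 < pmf \<pi> x"
    and "transition_matrix P"
    and "reversible \<pi> P"
  defines "F \<equiv> (\<lambda>S. (frobenius_norm \<pi> (gibbs_kernel \<pi> S ** P - stationary_matrix \<pi>))\<^sup>2)"
    and "g \<equiv> two_step_flow \<pi> P"
    and "proper \<equiv> (\<lambda>S::'x set. S \<noteq> {} \<and> S \<noteq> UNIV)"
  shows "(\<forall>S. proper S \<longrightarrow> F S = 1 - g S)
    \<and> (\<forall>S. cheeger_cut \<pi> (P ** P) S \<longrightarrow> F S = 1 - cheeger_constant \<pi> (P ** P))
    \<and> {S. is_arg_min F proper S} = {S. is_arg_max g proper S}
    \<and> {S. is_arg_max F proper S} = {S. is_arg_min g proper S}"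
proof -
  have F: "F S = 1 - g S" if "proper S" for S
    using frobenius_norm_gibbs_kernel[OF assms(1-3), of S] that
    by (simp add: F_def g_def proper_def)
  have "F S = 1 - cheeger_constant \<pi> (P ** P)" if "cheeger_cut \<pi> (P ** P) S" for S
  proof -
    \<comment> \<open>Probability strictly between 0 and 1 excludes both \<open>{}\<close> and
      \<open>UNIV\<close>.\<close>
    have "proper S"
      using that by (auto simp: proper_def cheeger_cut_def cheeger_admissible_def)
    moreover have "g S = cheeger_constant \<pi> (P ** P)"
      using that by (simp add: g_def two_step_flow_def cheeger_cut_def cheeger_ratio_def)
    ultimately show ?thesis
      by (simp add: F)
  qed
  \<comment> \<open>Both notions compare values on proper sets only; there \<open>F\<close> is
    \<open>1 - g\<close>, which reverses the order.\<close>
  moreover have "is_arg_min F proper S \<longleftrightarrow> is_arg_max g proper S" for S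
    using F by (auto simp: is_arg_min_def is_arg_max_def)
  moreover have "is_arg_max F proper S \<longleftrightarrow> is_arg_min g proper S" for S
    using F by (auto simp: is_arg_min_def is_arg_max_def)
  ultimately show ?thesis
    using F by blast
qed

end
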